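(* Let $d,k\ge 1$ and let $\mathbf{P}=(P_1,\dots,P_k)$ be a collection of lattice polytopes in $\mathbb{R}^d$, each containing $0$, such that $P_1+\cdots+P_k$ has dimension $d$ and $$\dim(P_1+\cdots+P_k)=\dim P_1+\cdots+\dim P_k.$$ Then $\mathrm{DMV}(P_1,\dots,P_k)$ equals the number of lattice points $z\in(P_1+\cdots+P_k)\cap\mathbb{Z}^d$ that are not contained in any subsum $P_J$ with $J\subseteq[k]$, $J\neq[k]$.
   Context: A lattice polytope in $\mathbb{R}^d$ is the convex hull of a nonempty finite subset of $\mathbb{Z}^d$. For $J\subseteq[k]=\{1,\dots,k\}$ put $P_J:=\sum_{j\in J}P_j$ (Minkowski sum), with $P_\emptyset=\{0\}$. The discrete mixed volume is $$\mathrm{DMV}(P_1,\dots,P_k):=\sum_{J\subseteq[k]}(-1)^{k-|J|}\,|P_J\cap\mathbb{Z}^d|.$$ *)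

theory Defs
  imports "HOL-Analysis.Analysis"
begin

definition int_lattice :: "(real ^ 'n) set" where
  "int_lattice = {x. \<forall>i. x $ i \<in> \<int>}"

definition lattice_polytope :: "(real ^ 'n) set \<Rightarrow> bool" where
  "lattice_polytope S \<longleftrightarrow>
    (\<exists>V. finite V \<and> V \<noteq> {} \<and> V \<subseteq> int_lattice \<and> S = convex hull V)"

text \<open>
  Addition and zero of sets are those of \<^theory>\<open>HOL-Library.Set_Algebras\<close>,
  so this is a Minkowski sum, and the sum over the empty index set is the singleton of the
  origin.
\<close>

definition subsum :: "(nat \<Rightarrow> (real ^ 'n) set) \<Rightarrow> nat set \<Rightarrow> (real ^ 'n) set" where
  "subsum P J = (\<Sum>j\<in>J. P j)"

text \<open>
  For lattice polytopes the sets counted are finite; the library's \<^const>\<open>card\<close> is zero on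
  infinite sets. The natural number subtraction in the exponent never truncates.
\<close>

definition discrete_mixed_volume :: "nat \<Rightarrow> (nat \<Rightarrow> (real ^ 'n) set) \<Rightarrow> int" where
  "discrete_mixed_volume k P =
    (\<Sum>J\<in>Pow {1..k}. (-1) ^ (k - card J) * int (card (subsum P J \<inter> int_lattice)))"

end

theory Submission
  imports Defs
begin

text \<open>
  The dimension hypothesis makes the spans of the \<open>P j\<close> independent, so a point of
  \<open>P 1 + \<dots> + P k\<close> has exactly one decomposition, and it lies in \<open>subsum P J\<close> iff \<open>J\<close>
  contains the support of that decomposition. Summing over \<open>J\<close> first, each lattice point contributes
  an alternating sum over the supersets of its support, which vanishes unless the support is full.
\<close>

text \<open>A bound on the norm bounds every coordinate, so each point has its coordinates in one
  finite set of integers. Hence the cardinalities counted below are those of finite sets.\<close>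

lemma finite_bounded_Int_int_lattice:
  fixes S :: "(real ^ 'n) set"
  assumes "bounded S"
  shows "finite (S \<inter> int_lattice)"
proof -
  obtain B where B: "\<And>x. x \<in> S \<Longrightarrow> norm x \<le> B"
    using assms by (auto simp: bounded_iff)
  let ?Z = "{x :: real. x \<in> \<int> \<and> - B \<le> x \<and> x \<le> B}"
  have "x \<in> vec_lambda ` (UNIV \<rightarrow>\<^sub>E ?Z)" if "x \<in> S \<inter> int_lattice" for x
  proof
    show "x = vec_lambda (vec_nth x)" by simp
    show "vec_nth x \<in> UNIV \<rightarrow>\<^sub>E ?Z"
    proof
      fix i
      have "\<bar>x $ i\<bar> \<le> B"
        using that B[of x] component_le_norm_cart[of x i] by auto
      then show "x $ i \<in> ?Z"
        using that by (simp add: int_lattice_def abs_le_iff)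
    qed simp
  qed
  moreover have "finite (vec_lambda ` (UNIV \<rightarrow>\<^sub>E ?Z) :: (real ^ 'n) set)"
    by (intro finite_imageI finite_PiE finite_int_segment) simp
  ultimately show ?thesis
    by (meson finite_subset subsetI)
qed

lemma mem_subsum_iff:
  assumes "finite J"
  shows "z \<in> subsum P J \<longleftrightarrow> (\<exists>x. (\<forall>j\<in>J. x j \<in> P j) \<and> z = sum x J)"
  unfolding subsum_def set_sum_alt[OF assms] by blast

lemma bounded_subsum:
  assumes "finite J" "\<And>j. j \<in> J \<Longrightarrow> bounded (P j)"
  shows "bounded (subsum P J)"
  using assms
proof (induction J)
  case (insert j J)
  then have "bounded (P j + subsum P J)"
    using bounded_plus[of "P j" "subsum P J"] by (simp add: set_plus_image)
  then show ?case
    using insert.hyps by (simp add: subsum_def)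
qed (simp add: subsum_def)

lemma lattice_polytope_imp_bounded: "lattice_polytope S \<Longrightarrow> bounded S"
  unfolding lattice_polytope_def by (metis finite_imp_bounded_convex_hull)

text \<open>The dimension formula for the subspaces \<open>span A\<close> and \<open>span B\<close>,
  whose sum is \<open>span (A \<union> B)\<close>.\<close>

lemma dim_Un_Int:
  fixes A B :: "'a :: euclidean_space set"
  shows "dim (A \<union> B) + dim (span A \<inter> span B) = dim A + dim B"
  using dim_sums_Int[of "span A" "span B"] dim_span[of "A \<union> B"]
  unfolding span_Un by simp

lemma dim_UN_le_sum:
  fixes P :: "'i \<Rightarrow> 'a :: euclidean_space set"
  assumes "finite J"
  shows "dim (\<Union>j\<in>J. P j) \<le> (\<Sum>j\<in>J. dim (P j))"
  using assms
proof (induction J)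
  case (insert j J)
  then show ?case
    using dim_Un_Int[of "P j" "\<Union>j\<in>J. P j"] by simp
qed simp

text \<open>The dimension formula for \<open>P j\<close> against the union of the others leaves an
  excess equal to the dimension of the intersection. By subadditivity the others contribute at most
  the sum of their dimensions, so equality in the total forces the excess to be 0.\<close>

lemma span_Int_span_eq_zero:
  fixes P :: "'i \<Rightarrow> 'a :: euclidean_space set"
  assumes "finite I" "j \<in> I" and dim: "dim (\<Union>i\<in>I. P i) = (\<Sum>i\<in>I. dim (P i))"
  shows "span (P j) \<inter> span (\<Union>i\<in>I - {j}. P i) = {0}"
proof -
  have "P j \<union> (\<Union>i\<in>I - {j}. P i) = (\<Union>i\<in>I. P i)"
    using \<open>j \<in> I\<close> by auto
  moreover have "(\<Sum>i\<in>I. dim (P i)) = dim (P j) + (\<Sum>i\<in>I - {j}. dim (P i))"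
    using assms by (simp add: sum.remove)
  ultimately have "dim (span (P j) \<inter> span (\<Union>i\<in>I - {j}. P i)) \<le> 0"
    using dim_Un_Int[of "P j" "\<Union>i\<in>I - {j}. P i"] dim_UN_le_sum[of "I - {j}" P] assms
    by (simp del: dim_eq_0 le_zero_eq)
  then have "span (P j) \<inter> span (\<Union>i\<in>I - {j}. P i) \<subseteq> {0}"
    by (simp only: le_zero_eq dim_eq_0)
  then show ?thesis
    using span_zero by blast
qed

text \<open>Isolating index \<open>j\<close> in the difference of the two sums places
  \<open>x j - y j\<close> both in \<open>span (P j)\<close> and in the span of the other sets, and
  these meet only in 0. Working in spans admits differences, and also 0 as a summand.\<close>

lemma sum_span_unique:
  fixes P :: "'i \<Rightarrow> 'a :: euclidean_space set"
  assumes "finite I" and dim: "dim (\<Union>i\<in>I. P i) = (\<Sum>i\<in>I. dim (P i))"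
    and x: "\<And>i. i \<in> I \<Longrightarrow> x i \<in> span (P i)" and y: "\<And>i. i \<in> I \<Longrightarrow> y i \<in> span (P i)"
    and eq: "sum x I = sum y I" and "j \<in> I"
  shows "x j = y j"
proof -
  have "(\<Sum>i\<in>I - {j}. y i - x i) \<in> span (\<Union>i\<in>I - {j}. P i)"
  proof (rule span_sum)
    fix i assume i: "i \<in> I - {j}"
    then have "y i - x i \<in> span (P i)"
      using x y by (intro span_diff) auto
    moreover have "span (P i) \<subseteq> span (\<Union>i\<in>I - {j}. P i)"
      using i by (intro span_mono) auto
    ultimately show "y i - x i \<in> span (\<Union>i\<in>I - {j}. P i)" by blast
  qed
  moreover have "x j - y j = (\<Sum>i\<in>I - {j}. y i - x i)"
    using eq \<open>finite I\<close> \<open>j \<in> I\<close>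
    by (simp add: sum_subtractf sum.remove[of I j] algebra_simps)
  ultimately have "x j - y j \<in> span (P j) \<inter> span (\<Union>i\<in>I - {j}. P i)"
    using x[OF \<open>j \<in> I\<close>] y[OF \<open>j \<in> I\<close>] by (metis IntI span_diff)
  then show ?thesis
    using span_Int_span_eq_zero[OF \<open>finite I\<close> \<open>j \<in> I\<close> dim] by simp
qed

lemma subsum_mono:
  assumes "finite N" "J \<subseteq> N" "\<And>j. j \<in> N \<Longrightarrow> 0 \<in> P j"
  shows "subsum P J \<subseteq> subsum P N"
proof
  fix z assume "z \<in> subsum P J"
  then obtain x where x: "\<forall>j\<in>J. x j \<in> P j" "z = sum x J"
    using assms finite_subset by (metis mem_subsum_iff)
  \<comment> \<open>The missing summands are filled with 0, which lies in every
    \<open>P j\<close>.\<close>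
  have "z = (\<Sum>j\<in>N. if j \<in> J then x j else 0)"
    using assms x(2) by (simp add: sum.If_cases Int_absorb1)
  then show "z \<in> subsum P N"
    using x(1) assms
    by (subst mem_subsum_iff) (auto intro!: exI[of _ "\<lambda>j. if j \<in> J then x j else 0"])
qed

lemma subsum_support:
  fixes P :: "nat \<Rightarrow> (real ^ 'n) set"
  assumes "finite N" and dim: "dim (\<Union>i\<in>N. P i) = (\<Sum>i\<in>N. dim (P i))"
    and "z \<in> subsum P N"
  obtains K where "K \<subseteq> N" "\<And>J. J \<subseteq> N \<Longrightarrow> z \<in> subsum P J \<longleftrightarrow> K \<subseteq> J"
proof -
  obtain x where x: "\<And>j. j \<in> N \<Longrightarrow> x j \<in> P j" "z = sum x N"
    using assms by (auto simp: mem_subsum_iff)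
  \<comment> \<open>The support of one fixed decomposition; uniqueness makes it serve for every
    \<open>J\<close> at once.\<close>
  let ?K = "{j \<in> N. x j \<noteq> 0}"
  have "z \<in> subsum P J \<longleftrightarrow> ?K \<subseteq> J" if J: "J \<subseteq> N" for J
  proof -
    from J have "finite J"
      using \<open>finite N\<close> finite_subset by blast
    show "z \<in> subsum P J \<longleftrightarrow> ?K \<subseteq> J"
    proof
      assume "z \<in> subsum P J"
      then obtain y where y: "\<forall>j\<in>J. y j \<in> P j" "z = sum y J"
        using \<open>finite J\<close> by (auto simp: mem_subsum_iff)
      \<comment> \<open>Extended by 0, the decomposition over \<open>J\<close> competes with
        \<open>x\<close> over all of \<open>N\<close>. Since 0 lies in every span, uniqueness
        applies, so \<open>x\<close> vanishes outside \<open>J\<close>.\<close>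
      define y' where "y' j = (if j \<in> J then y j else 0)" for j
      have "sum y' N = z"
        using J \<open>finite N\<close> y(2) by (simp add: y'_def sum.If_cases Int_absorb1)
      then have "x j = y' j" if "j \<in> N" for j
        using that sum_span_unique[OF \<open>finite N\<close> dim, of x y' j] x y(1)
        by (simp add: y'_def span_base span_zero)
      then show "?K \<subseteq> J"
        by (auto simp: y'_def split: if_splits)
    next
      assume "?K \<subseteq> J"
      then have "sum x J = z"
        using J \<open>finite N\<close> x(2) by (auto intro: sum.mono_neutral_left)
      then show "z \<in> subsum P J"
        using x(1) J \<open>finite J\<close> by (auto simp: mem_subsum_iff)
    qed
  qed
  then show thesis
    using that[of ?K] by blast
qed

text \<open>If \<open>K\<close> is a proper subset of \<open>N\<close>, as many sets between
  \<open>K\<close> and \<open>N\<close> have even as have odd cardinality, so the signs cancel; if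
  \<open>K = N\<close>, the single term is 1.\<close>

lemma sum_supersets_alternating:
  assumes "finite N" "K \<subseteq> N"
  shows "(\<Sum>J \<in> {J. K \<subseteq> J \<and> J \<subseteq> N}. (- 1) ^ (card N - card J)) = (of_bool (K = N) :: int)"
proof (cases "K = N")
  case True
  then have "{J. K \<subseteq> J \<and> J \<subseteq> N} = {N}" by auto
  with True show ?thesis by simp
next
  case False
  let ?S = "{J. K \<subseteq> J \<and> J \<subseteq> N}"
  have "finite ?S"
    using assms(1) by simp
  have "(\<Sum>J\<in>?S. (- 1) ^ card J) = (0 :: int)"
    using card_subsupersets_even_odd[of N K] assms False \<open>finite ?S\<close>
    by (intro sum_alternating_cancels) (simp_all add: psubset_eq conj_ac)
  \<comment> \<open>As \<open>card J \<le> card N\<close>, the subtraction is exact and the exponent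
    has the parity of \<open>card N + card J\<close>.\<close>
  moreover have "(- 1) ^ (card N - card J) = (- 1) ^ card N * ((- 1) ^ card J :: int)" if "J \<in> ?S" for J
    using that assms(1) card_mono[of N J]
    by (auto simp: minus_one_power_iff)
  ultimately show ?thesis
    using False by (simp add: sum_distrib_left[symmetric])
qed

theorem proposition2p9:
  fixes k :: nat and P :: "nat \<Rightarrow> (real ^ 'n) set"
  assumes "k \<ge> 1"
    and "\<And>j. j \<in> {1..k} \<Longrightarrow> lattice_polytope (P j)"
    and "\<And>j. j \<in> {1..k} \<Longrightarrow> 0 \<in> P j"
    and "aff_dim (subsum P {1..k}) = int CARD('n)"
    and "aff_dim (subsum P {1..k}) = (\<Sum>j\<in>{1..k}. aff_dim (P j))"
  shows "discrete_mixed_volume k P =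
    int (card {z \<in> subsum P {1..k} \<inter> int_lattice.
                 \<forall>J. J \<subseteq> {1..k} \<and> J \<noteq> {1..k} \<longrightarrow> z \<notin> subsum P J})"
proof -
  let ?N = "{1..k}"
  let ?A = "subsum P ?N \<inter> int_lattice"
  let ?new = "\<lambda>z. \<forall>J. J \<subseteq> ?N \<and> J \<noteq> ?N \<longrightarrow> z \<notin> subsum P J"
  \<comment> \<open>For a set containing 0 the affine dimension is the linear one, so the hypotheses
    become statements about \<open>dim\<close>.\<close>
  have "0 \<in> subsum P ?N"
    using assms(3) by (subst mem_subsum_iff) (auto intro!: exI[of _ "\<lambda>_. 0"])
  then have "dim (subsum P ?N) = CARD('n)"
    using assms(4) aff_dim_zero[of "subsum P ?N"] by (simp add: hull_inc)
  moreover have "subsum P ?N \<subseteq> span (\<Union>j\<in>?N. P j)"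
  proof
    fix z assume "z \<in> subsum P ?N"
    then obtain x where "\<forall>j\<in>?N. x j \<in> P j" and z: "z = sum x ?N"
      by (auto simp: mem_subsum_iff)
    then have "x j \<in> span (\<Union>j\<in>?N. P j)" if "j \<in> ?N" for j
      using that by (blast intro: span_base)
    then show "z \<in> span (\<Union>j\<in>?N. P j)"
      unfolding z by (rule span_sum)
  qed
  ultimately have "CARD('n) \<le> dim (\<Union>j\<in>?N. P j)"
    by (metis dim_span dim_subset)
  moreover have "(\<Sum>j\<in>?N. dim (P j)) = CARD('n)"
  proof -
    have "(\<Sum>j\<in>?N. aff_dim (P j)) = (\<Sum>j\<in>?N. int (dim (P j)))"
      using assms(3) by (intro sum.cong aff_dim_zero hull_inc) auto
    then show ?thesis
      using assms(4,5) by (simp flip: of_nat_sum)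
  qed
  \<comment> \<open>The left side is at least \<open>CARD('n)\<close>, which is the value of the
    right side; subadditivity gives the other inequality.\<close>
  ultimately have dim: "dim (\<Union>j\<in>?N. P j) = (\<Sum>j\<in>?N. dim (P j))"
    using dim_UN_le_sum[of ?N P] by simp
  have fin: "finite ?A"
    using assms(2)
    by (intro finite_bounded_Int_int_lattice bounded_subsum lattice_polytope_imp_bounded) auto
  \<comment> \<open>Each subsum lies in the full sum, so all counts become indicator sums over the
    same set \<open>?A\<close>, and the two summations can be exchanged.\<close>
  have count: "int (card (subsum P J \<inter> int_lattice)) = (\<Sum>z\<in>?A. of_bool (z \<in> subsum P J))"
    if "J \<in> Pow ?N" for J
  proof -
    have "subsum P J \<inter> int_lattice = ?A \<inter> {z. z \<in> subsum P J}"
      using subsum_mono[of ?N J P] that assms(3) by auto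
    then show ?thesis
      using fin by (simp add: sum.If_cases of_bool_def)
  qed
  have contribution: "(\<Sum>J\<in>Pow ?N. (- 1) ^ (k - card J) * of_bool (z \<in> subsum P J)) =
      (of_bool (?new z) :: int)" if z: "z \<in> ?A" for z
  proof -
    obtain K where K: "K \<subseteq> ?N" "\<And>J. J \<subseteq> ?N \<Longrightarrow> z \<in> subsum P J \<longleftrightarrow> K \<subseteq> J"
      using subsum_support[of ?N P z] dim z by auto
    have "(\<Sum>J\<in>Pow ?N. (- 1) ^ (k - card J) * of_bool (z \<in> subsum P J)) =
        (\<Sum>J \<in> {J. K \<subseteq> J \<and> J \<subseteq> ?N}. (- 1) ^ (card ?N - card J) :: int)"
      using K(2) by (intro sum.mono_neutral_cong_right) auto
    also have "\<dots> = of_bool (K = ?N)"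
      using K(1) by (intro sum_supersets_alternating) auto
    \<comment> \<open>Taking \<open>J = K\<close> shows that \<open>z\<close> lies in
      \<open>subsum P K\<close>, which is a proper subsum unless \<open>K = ?N\<close>; if
      \<open>K = ?N\<close>, only \<open>J = ?N\<close> contains \<open>K\<close>.\<close>
    also have "K = ?N \<longleftrightarrow> ?new z"
      by (metis K order_refl subset_antisym)
    finally show ?thesis .
  qed
  have "discrete_mixed_volume k P =
      (\<Sum>J\<in>Pow ?N. \<Sum>z\<in>?A. (- 1) ^ (k - card J) * of_bool (z \<in> subsum P J))"
    unfolding discrete_mixed_volume_def
    by (intro sum.cong refl) (simp only: count sum_distrib_left)
  also have "\<dots> = (\<Sum>z\<in>?A. of_bool (?new z))"
    by (subst sum.swap) (intro sum.cong refl contribution)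
  also have "\<dots> = int (card {z \<in> ?A. ?new z})"
    using fin by (simp add: sum.If_cases of_bool_def Int_def)
  finally show ?thesis .
qed

end
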